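(* Let $T$ be the Green operator defined by $Tf(x)=\int_a^b 2e^{-W(z)}g(z,x)f(z)\,dz$, where $g(x,\xi)=-C\,u(x)v(\xi)$ for $a\le x\le \xi$ and $g(x,\xi)=-C\,u(\xi)v(x)$ for $\xi\le x\le b$, with $C=\int_a^b e^{W(z)}dz$, $u(x)=\frac1C\int_a^x e^{W(z)}dz$ and $v(x)=\frac1C\int_x^b e^{W(z)}dz$. Then $T(Lf)(x)=f(x)$ for all $f\in D(L)$, and $L(Th)(x)=h(x)$ for all $h\in L^2([a,b])$, the latter being an equality of elements of $L^2([a,b])$, i.e. for almost every $x$.
   Context: Fix $a<b$ and a realization (environment) of a two-sided Brownian motion $W$, so that $W:\mathbb{R}\to\mathbb{R}$ is a fixed continuous function. The operator $L$ (the generator of the Brox diffusion killed at $a$ and $b$) acts by $Lf(x)=\frac{e^{W(x)}}{2}\left(e^{-W(x)}f'(x)\right)'$. Its domain $D(L)$ consists of the differentiable functions $f$ on $[a,b]$ with $f(a)=f(b)=0$ and $f'(x)=e^{W(x)}g_0(x)$ with $g_0$ of class $C^1$. On functions $Th$ with $h\in L^2([a,b])$, $L$ is applied through the same formula, with the outer derivative understood almost everywhere. *)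

theory Defs
  imports "HOL-Analysis.Analysis"
begin

text \<open>
  The environment \<open>W\<close> and the end points \<open>a < b\<close> are explicit parameters throughout. Functions on
  \<open>[a, b]\<close> are represented by functions on all of \<open>\<real>\<close>; derivatives are taken within \<open>[a, b]\<close>
  (one-sided at the end points), so that values outside \<open>[a, b]\<close> play no role.
\<close>

definition deriv_on :: "real \<Rightarrow> real \<Rightarrow> (real \<Rightarrow> real) \<Rightarrow> real \<Rightarrow> real" where
  "deriv_on a b f x = vector_derivative f (at x within {a..b})"

definition C1_on :: "real \<Rightarrow> real \<Rightarrow> (real \<Rightarrow> real) \<Rightarrow> bool" where
  "C1_on a b f \<longleftrightarrow> f differentiable_on {a..b} \<and> continuous_on {a..b} (deriv_on a b f)"

text \<open>
  \<open>flux W a b f\<close> is \<open>e\<^sup>-\<^sup>W f'\<close>, the function to which the outer derivative in the generator is applied.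
  As \<open>deriv_on\<close> is total, \<open>brox_gen W a b f x\<close> is meaningful only where \<open>flux W a b f\<close> is
  differentiable.
\<close>

definition flux :: "(real \<Rightarrow> real) \<Rightarrow> real \<Rightarrow> real \<Rightarrow> (real \<Rightarrow> real) \<Rightarrow> real \<Rightarrow> real" where
  "flux W a b f x = exp (- W x) * deriv_on a b f x"

definition brox_gen :: "(real \<Rightarrow> real) \<Rightarrow> real \<Rightarrow> real \<Rightarrow> (real \<Rightarrow> real) \<Rightarrow> real \<Rightarrow> real" where
  "brox_gen W a b f x = exp (W x) / 2 * deriv_on a b (flux W a b f) x"

definition brox_dom :: "(real \<Rightarrow> real) \<Rightarrow> real \<Rightarrow> real \<Rightarrow> (real \<Rightarrow> real) set" where
  "brox_dom W a b =
    {f. f differentiable_on {a..b} \<and> f a = 0 \<and> f b = 0 \<and>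
        (\<exists>g0. C1_on a b g0 \<and> (\<forall>x\<in>{a..b}. deriv_on a b f x = exp (W x) * g0 x))}"

definition scale_C :: "(real \<Rightarrow> real) \<Rightarrow> real \<Rightarrow> real \<Rightarrow> real" where
  "scale_C W a b = (LINT z|lebesgue_on {a..b}. exp (W z))"

definition scale_u :: "(real \<Rightarrow> real) \<Rightarrow> real \<Rightarrow> real \<Rightarrow> real \<Rightarrow> real" where
  "scale_u W a b x = 1 / scale_C W a b * (LINT z|lebesgue_on {a..x}. exp (W z))"

definition scale_v :: "(real \<Rightarrow> real) \<Rightarrow> real \<Rightarrow> real \<Rightarrow> real \<Rightarrow> real" where
  "scale_v W a b x = 1 / scale_C W a b * (LINT z|lebesgue_on {x..b}. exp (W z))"

definition green :: "(real \<Rightarrow> real) \<Rightarrow> real \<Rightarrow> real \<Rightarrow> real \<Rightarrow> real \<Rightarrow> real" where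
  "green W a b x \<xi> =
    (if x \<le> \<xi> then - scale_C W a b * scale_u W a b x * scale_v W a b \<xi>
     else - scale_C W a b * scale_u W a b \<xi> * scale_v W a b x)"

definition green_op :: "(real \<Rightarrow> real) \<Rightarrow> real \<Rightarrow> real \<Rightarrow> (real \<Rightarrow> real) \<Rightarrow> real \<Rightarrow> real" where
  "green_op W a b f x = (LINT z|lebesgue_on {a..b}. 2 * exp (- W z) * green W a b z x * f z)"

text \<open>
  Members are representatives; equality of elements of \<open>L\<^sup>2\<close> is equality almost everywhere.
\<close>

definition L2_on :: "real \<Rightarrow> real \<Rightarrow> (real \<Rightarrow> real) set" where
  "L2_on a b = {h. h \<in> borel_measurable (lebesgue_on {a..b}) \<and>
                   integrable (lebesgue_on {a..b}) (\<lambda>x. (h x)\<^sup>2)}"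

end

theory Submission imports Defs begin

text \<open>
  Write \<open>s\<close> for the integral of \<open>e\<^sup>W\<close> from \<open>a\<close>, and \<open>m = 2 e\<^sup>-\<^sup>W h\<close> for the source in the equation
  \<open>L F = h\<close>, which says that the flux \<open>e\<^sup>-\<^sup>W F'\<close> has derivative \<open>m\<close>. Since \<open>C u = s\<close> and \<open>C v = s b - s\<close>
  with \<open>C = s b\<close>, the Green kernel is \<open>s z s x / s b - s (min z x)\<close> (\<open>green_eq\<close>). Hence, on \<open>[a, b]\<close>, \<open>T h\<close> is
  a multiple of \<open>s\<close> minus \<open>D x = \<integral> s (min z x) m z dz\<close> (\<open>green_op_eq\<close>).

  For integrable \<open>m\<close> the function \<open>D\<close> is differentiable at every point, with derivative
  \<open>e\<^sup>W \<integral>\<^sub>x\<^sup>b m\<close> (\<open>stopped_integral_has_vector_derivative\<close>). The flux of \<open>T h\<close> is therefore a constant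
  minus \<open>\<integral>\<^sub>x\<^sup>b m\<close>, everywhere, and Lebesgue's differentiation theorem
  (\<open>indefinite_integral_has_vector_derivative_AE\<close>) gives it the derivative \<open>m\<close> almost everywhere.
  That is \<open>L (T h) = h\<close>; square integrable \<open>h\<close> qualify because the interval is bounded.

  For \<open>T (L f) = f\<close>, the function \<open>T (L f)\<close> has the same source as \<open>f\<close>, so their difference has constant
  flux and is an affine function of \<open>s\<close>. It vanishes at \<open>a\<close> and at \<open>b\<close>, hence everywhere
  (\<open>green_op_brox_gen\<close>).
\<close>

section \<open>Lebesgue's differentiation theorem on an interval\<close>

text \<open>
  By \<open>integrable_ccontinuous_explicit\<close>, the averages of an integrable function over the cubes to the
  upper right of a point converge almost everywhere; on the line this is the right-hand derivative
  of the indefinite integral. The same fact for the reflected function gives the left-hand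
  derivative. The function is extended by \<open>0\<close> to be integrable on every interval, and the end points
  are put into the null set so that both one-sided derivatives are available at the other points.
\<close>

lemma indefinite_integral_has_vector_derivative_AE:
  fixes f :: "real \<Rightarrow> real"
  assumes f: "f integrable_on {a..b}"
  obtains N where "negligible N"
    "\<And>x. x \<in> {a..b} - N \<Longrightarrow>
      ((\<lambda>t. integral {a..t} f) has_vector_derivative f x) (at x within {a..b})"
proof -
  define f0 where "f0 x = (if x \<in> {a..b} then f x else 0)" for x
  have f0_eq: "f0 x = f x" if "x \<in> {a..b}" for x
    using that by (simp add: f0_def)
  have "f0 integrable_on UNIV"
    using f unfolding f0_def by (subst Henstock_Kurzweil_Integration.integrable_restrict_UNIV)
  then have int0: "f0 integrable_on cbox c d" for c d
    using integrable_on_subcbox by blast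
  have int0r: "(\<lambda>x. f0 (- x)) integrable_on cbox c d" for c d
    using int0[of "-d" "-c"] integrable_reflect[of f0 "-c" "-d"] by simp
  obtain N1 where N1: "negligible N1"
    and right: "\<And>x e. \<lbrakk>x \<notin> N1; 0 < e\<rbrakk> \<Longrightarrow>
      \<exists>d>0. \<forall>h. 0 < h \<and> h < d \<longrightarrow> norm (integral (cbox x (x + h *\<^sub>R One)) f0 /\<^sub>R h ^ DIM(real) - f0 x) < e"
    using integrable_ccontinuous_explicit[OF int0] by blast
  obtain N2 where N2: "negligible N2"
    and left: "\<And>x e. \<lbrakk>x \<notin> N2; 0 < e\<rbrakk> \<Longrightarrow>
      \<exists>d>0. \<forall>h. 0 < h \<and> h < d \<longrightarrow> norm (integral (cbox x (x + h *\<^sub>R One)) (\<lambda>x. f0 (- x)) /\<^sub>R h ^ DIM(real) - f0 (- x)) < e"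
    using integrable_ccontinuous_explicit[OF int0r] by blast
  define N where "N = N1 \<union> uminus ` N2 \<union> {a, b}"
  have "negligible (uminus ` N2)"
    by (intro negligible_differentiable_image_negligible N2 derivative_intros) simp
  then have "negligible N"
    using N1 by (simp add: N_def)
  moreover have "((\<lambda>t. integral {a..t} f) has_vector_derivative f x) (at x within {a..b})"
    if x: "x \<in> {a..b} - N" for x
  proof -
    have xab: "a < x" "x < b" and xN1: "x \<notin> N1" and xN2: "- x \<notin> N2"
      using x by (auto simp: N_def image_iff)
    have split: "integral {a..v} f - integral {a..u} f = integral {u..v} f0"
      if "a \<le> u" "u \<le> v" "v \<le> b" for u v
    proof -
      have "integral {a..u} f + integral {u..v} f = integral {a..v} f"
        using that by (intro Henstock_Kurzweil_Integration.integral_combine integrable_on_subinterval[OF f]) auto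
      moreover have "integral {u..v} f = integral {u..v} f0"
        using that by (intro Henstock_Kurzweil_Integration.integral_cong) (auto simp: f0_def)
      ultimately show ?thesis by simp
    qed
    have "\<exists>d>0. \<forall>y\<in>{a..b}. norm (y - x) < d \<longrightarrow>
        norm (integral {a..y} f - integral {a..x} f - (y - x) *\<^sub>R f x) \<le> e * norm (y - x)"
      if e: "e > 0" for e
    proof -
      obtain d1 where d1: "d1 > 0"
        and D1: "\<And>h. 0 < h \<Longrightarrow> h < d1 \<Longrightarrow> \<bar>integral {x..x + h} f0 / h - f0 x\<bar> < e"
        using right[OF xN1 e] by (auto simp: divide_inverse_commute)
      obtain d2 where d2: "d2 > 0"
        and D2: "\<And>h. 0 < h \<Longrightarrow> h < d2 \<Longrightarrow> \<bar>integral {-x..-x + h} (\<lambda>x. f0 (- x)) / h - f0 x\<bar> < e"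
        using left[OF xN2 e] by (auto simp: divide_inverse_commute)
      have scale: "\<bar>I - h * c\<bar> \<le> e * h" if "\<bar>I / h - c\<bar> < e" "0 < h" for I h c :: real
      proof -
        have "\<bar>I - h * c\<bar> = \<bar>I / h - c\<bar> * h"
          using that(2) by (simp add: abs_mult_pos field_simps)
        also have "\<dots> \<le> e * h"
          using that by (intro mult_right_mono) auto
        finally show ?thesis .
      qed
      have "norm (integral {a..y} f - integral {a..x} f - (y - x) *\<^sub>R f x) \<le> e * norm (y - x)"
        if y: "y \<in> {a..b}" "norm (y - x) < min d1 d2" for y
      proof (cases y x rule: linorder_cases)
        case equal
        then show ?thesis by simp
      next
        case greater
        have "\<bar>integral {x..y} f0 - (y - x) * f0 x\<bar> \<le> e * (y - x)"
          using scale[OF D1[of "y - x"]] greater y by simp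
        then show ?thesis
          using split[of x y] f0_eq[of x] xab y greater by simp
      next
        case less
        have "integral {-x..-y} (\<lambda>x. f0 (- x)) = integral {y..x} f0"
          by (rule Henstock_Kurzweil_Integration.integral_reflect_real)
        then have "\<bar>integral {y..x} f0 - (x - y) * f0 x\<bar> \<le> e * (x - y)"
          using scale[OF D2[of "x - y"]] less y by simp
        then show ?thesis
          using split[of y x] f0_eq[of x] xab y less by (simp add: algebra_simps abs_if split: if_splits)
      qed
      then show ?thesis
        using d1 d2 by (intro exI[of _ "min d1 d2"]) auto
    qed
    then show ?thesis
      unfolding has_vector_derivative_def has_derivative_within_alt
      using bounded_linear_scaleR_left by blast
  qed
  ultimately show thesis
    using that by blast
qed

section \<open>Integrals against a stopped scale function\<close>

lemma integrable_continuous_mult: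
  fixes f c :: "real \<Rightarrow> real"
  assumes c: "continuous_on {a..b} c" and f: "integrable (lebesgue_on {a..b}) f"
  shows "integrable (lebesgue_on {a..b}) (\<lambda>x. c x * f x)"
proof -
  have "compact (c ` {a..b})"
    by (intro compact_continuous_image c compact_Icc)
  then obtain B where B: "\<And>x. x \<in> {a..b} \<Longrightarrow> \<bar>c x\<bar> \<le> B"
    using compact_imp_bounded bounded_iff by (metis imageI real_norm_def)
  have [measurable]: "c \<in> borel_measurable (lebesgue_on {a..b})"
    "f \<in> borel_measurable (lebesgue_on {a..b})"
    using continuous_imp_measurable_on_sets_lebesgue[OF c] f by auto
  show ?thesis
  proof (rule Bochner_Integration.integrable_bound)
    show "integrable (lebesgue_on {a..b}) (\<lambda>x. B * f x)"
      using f by simp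
    show "AE x in lebesgue_on {a..b}. norm (c x * f x) \<le> norm (B * f x)"
    proof (rule AE_I2)
      fix x assume "x \<in> space (lebesgue_on {a..b})"
      then have "\<bar>c x\<bar> \<le> B" using B by simp
      then show "norm (c x * f x) \<le> norm (B * f x)"
        by (simp add: abs_mult mult_right_mono)
    qed
  qed measurable
qed

text \<open>
  The function below is \<open>\<integral> s (min x z) m z dz\<close>. The product rule is not available, because \<open>m\<close> is merely
  integrable and so the two summands need not be differentiable one by one. But the points
  \<open>z \<ge> max x y\<close> contribute exactly \<open>(s y - s x) m z\<close> to the increment from \<open>x\<close> to \<open>y\<close>, so that
  linearization at \<open>x\<close> only errs between \<open>x\<close> and \<open>y\<close>, by at most \<open>\<bar>s y - s x\<bar>\<close> times the integral of
  \<open>\<bar>m\<bar>\<close> there, and that is of smaller order than \<open>y - x\<close>. Hence the derivative exists at every point.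
\<close>

lemma stopped_integral_has_vector_derivative:
  fixes s m :: "real \<Rightarrow> real"
  assumes m: "integrable (lebesgue_on {a..b}) m"
    and mono: "mono_on {a..b} s" and cont: "continuous_on {a..b} s"
    and x: "x \<in> {a..b}" and s': "(s has_vector_derivative s') (at x within {a..b})"
  shows "((\<lambda>x. integral {a..x} (\<lambda>z. s z * m z) + s x * integral {x..b} m)
    has_vector_derivative s' * integral {x..b} m) (at x within {a..b})"
proof -
  let ?D = "\<lambda>x. integral {a..x} (\<lambda>z. s z * m z) + s x * integral {x..b} m"
  let ?A = "\<lambda>x. integral {a..x} (\<lambda>z. \<bar>m z\<bar>)"
  have m_int: "m integrable_on {a..b}" and m_abs: "(\<lambda>z. \<bar>m z\<bar>) integrable_on {a..b}"
    and sm_int: "(\<lambda>z. s z * m z) integrable_on {a..b}"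
    using m integrable_continuous_mult[OF cont m] by (auto intro: integrable_on_lebesgue_on)
  have incr: "\<bar>?D v - ?D u - (s v - s u) * integral {w..b} m\<bar> \<le> (s v - s u) * (?A v - ?A u)"
    if uv: "a \<le> u" "u \<le> v" "v \<le> b" and w: "w = u \<or> w = v" for u v w
  proof -
    have sub: "{u..v} \<subseteq> {a..b}" "{a..v} \<subseteq> {a..b}" "{u..b} \<subseteq> {a..b}"
      using uv by auto
    have int: "m integrable_on {u..v}" "(\<lambda>z. \<bar>m z\<bar>) integrable_on {u..v}"
      "(\<lambda>z. s z * m z) integrable_on {u..v}"
      using sub(1) m_int m_abs sm_int integrable_on_subinterval by blast+
    have c1: "integral {a..u} (\<lambda>z. s z * m z) + integral {u..v} (\<lambda>z. s z * m z)
        = integral {a..v} (\<lambda>z. s z * m z)"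
      using uv by (intro Henstock_Kurzweil_Integration.integral_combine integrable_on_subinterval[OF sm_int sub(2)])
    have c2: "integral {u..v} m + integral {v..b} m = integral {u..b} m"
      using uv by (intro Henstock_Kurzweil_Integration.integral_combine integrable_on_subinterval[OF m_int sub(3)])
    have c3: "?A u + integral {u..v} (\<lambda>z. \<bar>m z\<bar>) = ?A v"
      using uv by (intro Henstock_Kurzweil_Integration.integral_combine integrable_on_subinterval[OF m_abs sub(2)])
    \<comment> \<open>Linearizing at one end of \<open>[u, v]\<close> leaves the deviation of \<open>s\<close> from its value at the other end.\<close>
    define k where "k = (if w = u then s v else s u)"
    have "?D v - ?D u - (s v - s u) * integral {w..b} m
        = integral {u..v} (\<lambda>z. s z * m z) - k * integral {u..v} m"
      unfolding c1[symmetric] c2[symmetric]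
      using w by (auto simp: k_def c2[symmetric] algebra_simps)
    also have "\<dots> = integral {u..v} (\<lambda>z. (s z - k) * m z)"
      using int by (simp add: Henstock_Kurzweil_Integration.integral_diff left_diff_distrib integrable_on_mult_right)
    finally have eq: "?D v - ?D u - (s v - s u) * integral {w..b} m
        = integral {u..v} (\<lambda>z. (s z - k) * m z)" .
    have "norm (integral {u..v} (\<lambda>z. (s z - k) * m z)) \<le> integral {u..v} (\<lambda>z. (s v - s u) * \<bar>m z\<bar>)"
    proof (rule Henstock_Kurzweil_Integration.integral_norm_bound_integral)
      show "(\<lambda>z. (s z - k) * m z) integrable_on {u..v}"
        using int by (auto simp: left_diff_distrib intro!: Henstock_Kurzweil_Integration.integrable_diff integrable_on_mult_right)
      show "(\<lambda>z. (s v - s u) * \<bar>m z\<bar>) integrable_on {u..v}"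
        using int by (intro integrable_on_mult_right)
      fix z assume "z \<in> {u..v}"
      then have "s u \<le> s z" "s z \<le> s v"
        using mono uv by (auto intro: mono_onD)
      then show "norm ((s z - k) * m z) \<le> (s v - s u) * \<bar>m z\<bar>"
        by (auto simp: abs_mult k_def intro!: mult_right_mono)
    qed
    also have "\<dots> = (s v - s u) * (?A v - ?A u)"
      using c3 by simp
    finally show ?thesis
      using eq by simp
  qed
  have A_cont: "continuous_on {a..b} ?A"
    using indefinite_integral_continuous_1[OF m_abs] .
  have A_tendsto: "((\<lambda>y. ?A y - ?A x) \<longlongrightarrow> 0) (at x within {a..b})"
    using A_cont x unfolding continuous_on_def by (intro LIM_zero) blast
  have s_tendsto: "((\<lambda>y. (s y - s x) / (y - x)) \<longlongrightarrow> s') (at x within {a..b})"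
    using s' by (simp add: has_real_derivative_iff_has_vector_derivative[symmetric] has_field_derivative_iff)
  have "((\<lambda>y. (?D y - ?D x) / (y - x) - (s y - s x) / (y - x) * integral {x..b} m) \<longlongrightarrow> 0)
      (at x within {a..b})"
  proof (rule Lim_null_comparison)
    show "((\<lambda>y. \<bar>(s y - s x) / (y - x)\<bar> * \<bar>?A y - ?A x\<bar>) \<longlongrightarrow> 0) (at x within {a..b})"
      by (intro tendsto_mult_right_zero tendsto_rabs_zero A_tendsto
          tendsto_eq_rhs[OF tendsto_mult[OF tendsto_rabs[OF s_tendsto] tendsto_rabs_zero[OF A_tendsto]]]) simp
    have "\<bar>(?D y - ?D x) / (y - x) - (s y - s x) / (y - x) * integral {x..b} m\<bar>
        \<le> \<bar>(s y - s x) / (y - x)\<bar> * \<bar>?A y - ?A x\<bar>" if y: "y \<in> {a..b}" for y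
    proof -
      have "\<bar>?D y - ?D x - (s y - s x) * integral {x..b} m\<bar> \<le> \<bar>s y - s x\<bar> * \<bar>?A y - ?A x\<bar>"
      proof (cases "x \<le> y")
        case True
        then have "\<bar>?D y - ?D x - (s y - s x) * integral {x..b} m\<bar> \<le> (s y - s x) * (?A y - ?A x)"
          using incr[of x y x] x y by simp
        also have "\<dots> \<le> \<bar>s y - s x\<bar> * \<bar>?A y - ?A x\<bar>"
          by (metis abs_ge_self abs_mult)
        finally show ?thesis .
      next
        case False
        have "\<bar>?D y - ?D x - (s y - s x) * integral {x..b} m\<bar>
            = \<bar>?D x - ?D y - (s x - s y) * integral {x..b} m\<bar>"
          by (subst abs_minus_cancel[symmetric]) (simp add: algebra_simps)
        also have "\<dots> \<le> (s x - s y) * (?A x - ?A y)"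
          using incr[of y x x] x y False by simp
        also have "\<dots> = (s y - s x) * (?A y - ?A x)"
          by (simp add: algebra_simps)
        also have "\<dots> \<le> \<bar>s y - s x\<bar> * \<bar>?A y - ?A x\<bar>"
          by (metis abs_ge_self abs_mult)
        finally show ?thesis .
      qed
      then have "\<bar>?D y - ?D x - (s y - s x) * integral {x..b} m\<bar> / \<bar>y - x\<bar>
          \<le> \<bar>s y - s x\<bar> * \<bar>?A y - ?A x\<bar> / \<bar>y - x\<bar>"
        by (rule divide_right_mono) simp
      moreover have "X / d - S / d * I = (X - S * I) / d" for X S I d :: real
        by (simp add: diff_divide_distrib)
      ultimately show ?thesis
        by (simp add: abs_divide)
    qed
    then show "\<forall>\<^sub>F y in at x within {a..b}.
        norm ((?D y - ?D x) / (y - x) - (s y - s x) / (y - x) * integral {x..b} m)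
        \<le> \<bar>(s y - s x) / (y - x)\<bar> * \<bar>?A y - ?A x\<bar>"
      by (auto simp: eventually_at_filter)
  qed
  from tendsto_add[OF this tendsto_mult_right[OF s_tendsto, of "integral {x..b} m"]]
  have "((\<lambda>y. (?D y - ?D x) / (y - x)) \<longlongrightarrow> s' * integral {x..b} m) (at x within {a..b})"
    by simp
  then show ?thesis
    by (simp add: has_real_derivative_iff_has_vector_derivative[symmetric] has_field_derivative_iff)
qed

section \<open>The Green operator in terms of the scale function\<close>

text \<open>
  The scale function of the diffusion, normalized to vanish at \<open>a\<close>. In terms of \<open>s = scale_fun W a\<close>,
  the functions \<open>u\<close> and \<open>v\<close> are \<open>s / s b\<close> and \<open>1 - s / s b\<close> on \<open>[a, b]\<close>.
\<close>

definition scale_fun :: "(real \<Rightarrow> real) \<Rightarrow> real \<Rightarrow> real \<Rightarrow> real" where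
  "scale_fun W a x = integral {a..x} (\<lambda>z. exp (W z))"

lemma scale_fun_left [simp]: "scale_fun W a a = 0"
  by (simp add: scale_fun_def)

lemma scale_fun_has_vector_derivative:
  assumes "continuous_on {a..b} W" "x \<in> {a..b}"
  shows "(scale_fun W a has_vector_derivative exp (W x)) (at x within {a..b})"
  unfolding scale_fun_def
  using assms by (intro integral_has_vector_derivative continuous_intros)

lemma continuous_on_scale_fun:
  assumes "continuous_on {a..b} W"
  shows "continuous_on {a..b} (scale_fun W a)"
  using scale_fun_has_vector_derivative[OF assms]
  unfolding continuous_on_eq_continuous_within by (metis has_vector_derivative_continuous)

lemma scale_fun_diff:
  assumes "continuous_on {a..b} W" "a \<le> x" "x \<le> y" "y \<le> b"
  shows "scale_fun W a y - scale_fun W a x = integral {x..y} (\<lambda>z. exp (W z))"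
proof -
  have "continuous_on {a..y} (\<lambda>z. exp (W z))"
    using assms by (intro continuous_intros continuous_on_subset[OF assms(1)]) auto
  then have "scale_fun W a x + integral {x..y} (\<lambda>z. exp (W z)) = scale_fun W a y"
    unfolding scale_fun_def using assms
    by (intro Henstock_Kurzweil_Integration.integral_combine integrable_continuous_real)
  then show ?thesis by simp
qed

lemma mono_on_scale_fun:
  assumes "continuous_on {a..b} W"
  shows "mono_on {a..b} (scale_fun W a)"
proof (rule mono_onI)
  fix x y assume xy: "x \<in> {a..b}" "y \<in> {a..b}" "x \<le> y"
  have "continuous_on {x..y} (\<lambda>z. exp (W z))"
    using xy by (intro continuous_intros continuous_on_subset[OF assms]) auto
  then have "0 \<le> integral {x..y} (\<lambda>z. exp (W z))"
    by (intro Henstock_Kurzweil_Integration.integral_nonneg integrable_continuous_real) auto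
  then show "scale_fun W a x \<le> scale_fun W a y"
    using scale_fun_diff[OF assms, of x y] xy by simp
qed

lemma scale_fun_pos:
  assumes W: "continuous_on {a..b} W" and "a < b"
  shows "0 < scale_fun W a b"
proof -
  have "integral {a..b} (\<lambda>_. 0) < integral {a..b} (\<lambda>z. exp (W z))"
    using assms by (intro integral_less_real continuous_intros) auto
  then show ?thesis by (simp add: scale_fun_def)
qed

lemma green_eq:
  assumes W: "continuous_on {a..b} W" and "a < b" and z: "z \<in> {a..b}" and x: "x \<in> {a..b}"
  shows "green W a b z x =
    scale_fun W a z * scale_fun W a x / scale_fun W a b - scale_fun W a (min z x)"
proof -
  have lint: "(LINT t|lebesgue_on {c..d}. exp (W t)) = integral {c..d} (\<lambda>t. exp (W t))"
    if "{c..d} \<subseteq> {a..b}" for c d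
    by (intro lebesgue_integral_eq_integral continuous_imp_integrable_real continuous_intros
        continuous_on_subset[OF W] that) simp
  have C: "scale_C W a b = scale_fun W a b"
    unfolding scale_C_def scale_fun_def by (intro lint) simp
  have u: "scale_u W a b y = scale_fun W a y / scale_fun W a b" if "y \<in> {a..b}" for y
    using that by (simp add: scale_u_def C lint scale_fun_def)
  have v: "scale_v W a b y = (scale_fun W a b - scale_fun W a y) / scale_fun W a b"
    if "y \<in> {a..b}" for y
    using that scale_fun_diff[OF W, of y b] by (simp add: scale_v_def C lint)
  show ?thesis
    using scale_fun_pos[OF W \<open>a < b\<close>] z x
    by (simp add: green_def u v C min_def field_simps)
qed

text \<open>
  The second term of \<open>green_eq\<close> is split at \<open>z = x\<close>, where the minimum changes its branch.
\<close>

lemma green_op_eq: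
  fixes h :: "real \<Rightarrow> real"
  assumes W: "continuous_on {a..b} W" and "a < b"
    and h: "integrable (lebesgue_on {a..b}) h" and x: "x \<in> {a..b}"
  defines "m \<equiv> \<lambda>z. 2 * exp (- W z) * h z"
  defines "K \<equiv> integral {a..b} (\<lambda>z. scale_fun W a z * m z) / scale_fun W a b"
  shows "green_op W a b h x = K * scale_fun W a x -
    (integral {a..x} (\<lambda>z. scale_fun W a z * m z) + scale_fun W a x * integral {x..b} m)"
proof -
  let ?s = "scale_fun W a"
  have m: "integrable (lebesgue_on {a..b}) m"
    unfolding m_def by (intro integrable_continuous_mult h continuous_intros W)
  have cont: "continuous_on {a..b} ?s"
    using W by (rule continuous_on_scale_fun)
  have "continuous_on {a..b} (\<lambda>z. ?s (min z x))"
    using x by (intro continuous_on_compose2[OF cont] continuous_intros) auto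
  note sm = integrable_continuous_mult[OF cont m] and minm = integrable_continuous_mult[OF this m]
  have minm_int: "(\<lambda>z. ?s (min z x) * m z) integrable_on {a..b}"
    using minm by (auto intro: integrable_on_lebesgue_on)
  have "green_op W a b h x
      = (LINT z|lebesgue_on {a..b}. ?s x / ?s b * (?s z * m z) - ?s (min z x) * m z)"
    unfolding green_op_def
    using x \<open>a < b\<close>
    by (intro Bochner_Integration.integral_cong)
      (auto simp: green_eq[OF W] m_def field_simps)
  also have "\<dots> = ?s x / ?s b * (LINT z|lebesgue_on {a..b}. ?s z * m z)
      - (LINT z|lebesgue_on {a..b}. ?s (min z x) * m z)"
    using sm minm by simp
  also have "(LINT z|lebesgue_on {a..b}. ?s z * m z) = integral {a..b} (\<lambda>z. ?s z * m z)"
    by (intro lebesgue_integral_eq_integral sm) simp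
  also have "(LINT z|lebesgue_on {a..b}. ?s (min z x) * m z)
      = integral {a..b} (\<lambda>z. ?s (min z x) * m z)"
    by (intro lebesgue_integral_eq_integral minm) simp
  also have "\<dots> = integral {a..x} (\<lambda>z. ?s (min z x) * m z)
      + integral {x..b} (\<lambda>z. ?s (min z x) * m z)"
    using x by (intro Henstock_Kurzweil_Integration.integral_combine[symmetric] minm_int) auto
  also have "integral {a..x} (\<lambda>z. ?s (min z x) * m z) = integral {a..x} (\<lambda>z. ?s z * m z)"
    by (intro Henstock_Kurzweil_Integration.integral_cong) (simp add: min_absorb1)
  also have "integral {x..b} (\<lambda>z. ?s (min z x) * m z) = integral {x..b} (\<lambda>z. ?s x * m z)"
    by (intro Henstock_Kurzweil_Integration.integral_cong) (simp add: min_absorb2)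
  finally show ?thesis
    by (simp add: K_def)
qed

lemma green_op_boundary:
  assumes "continuous_on {a..b} W" "a < b" "integrable (lebesgue_on {a..b}) h"
  shows "green_op W a b h a = 0" "green_op W a b h b = 0"
  using green_op_eq[OF assms, of a] green_op_eq[OF assms, of b] assms(2) scale_fun_pos[OF assms(1,2)]
  by simp_all

text \<open>
  The constant \<open>c\<close> is the flux at \<open>b\<close>; its value is what makes \<open>T h\<close> vanish at \<open>b\<close>.
\<close>

lemma green_op_has_vector_derivative:
  fixes h :: "real \<Rightarrow> real"
  assumes W: "continuous_on {a..b} W" and "a < b" and h: "integrable (lebesgue_on {a..b}) h"
  obtains c where "\<And>x. x \<in> {a..b} \<Longrightarrow>
    (green_op W a b h has_vector_derivative
      exp (W x) * (c - integral {x..b} (\<lambda>z. 2 * exp (- W z) * h z))) (at x within {a..b})"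
proof -
  define m where "m = (\<lambda>z. 2 * exp (- W z) * h z)"
  define K where "K = integral {a..b} (\<lambda>z. scale_fun W a z * m z) / scale_fun W a b"
  have m: "integrable (lebesgue_on {a..b}) m"
    unfolding m_def by (intro integrable_continuous_mult h continuous_intros W)
  show thesis
  proof (rule that)
    fix x assume x: "x \<in> {a..b}"
    note s' = scale_fun_has_vector_derivative[OF W x]
    have "((\<lambda>x. K * scale_fun W a x -
        (integral {a..x} (\<lambda>z. scale_fun W a z * m z) + scale_fun W a x * integral {x..b} m))
      has_vector_derivative K * exp (W x) - exp (W x) * integral {x..b} m) (at x within {a..b})"
      by (intro has_vector_derivative_diff has_vector_derivative_mult_right s'
          stopped_integral_has_vector_derivative m mono_on_scale_fun continuous_on_scale_fun W x)
    then have "(green_op W a b h has_vector_derivative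
        K * exp (W x) - exp (W x) * integral {x..b} m) (at x within {a..b})"
      by (rule has_vector_derivative_transform[rotated 2])
        (use x green_op_eq[OF W \<open>a < b\<close> h] in \<open>auto simp: m_def K_def\<close>)
    then show "(green_op W a b h has_vector_derivative
        exp (W x) * (K - integral {x..b} (\<lambda>z. 2 * exp (- W z) * h z))) (at x within {a..b})"
      by (simp add: m_def algebra_simps)
  qed
qed

section \<open>The generator and the Green operator are mutually inverse\<close>

lemma deriv_on_eq:
  assumes "a < b" "x \<in> {a..b}" "(f has_vector_derivative f') (at x within {a..b})"
  shows "deriv_on a b f x = f'"
  unfolding deriv_on_def using assms by (rule vector_derivative_within_closed_interval)

lemma has_vector_derivative_deriv_on:
  assumes "f differentiable_on {a..b}" "x \<in> {a..b}"
  shows "(f has_vector_derivative deriv_on a b f x) (at x within {a..b})"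
  using assms by (simp add: deriv_on_def differentiable_on_def vector_derivative_works)

text \<open>
  For \<open>h = L f\<close> the source \<open>2 e\<^sup>-\<^sup>W h\<close> is the derivative of the flux of \<open>f\<close>, so the fluxes of \<open>T (L f)\<close> and
  of \<open>f\<close> differ by a constant, and \<open>T (L f) - f\<close> is an affine function of the scale function. Such a
  function vanishes as soon as it vanishes at both end points.
\<close>

lemma green_op_brox_gen:
  assumes W: "continuous_on {a..b} W" and "a < b" and f: "f \<in> brox_dom W a b" and x: "x \<in> {a..b}"
  shows "green_op W a b (brox_gen W a b f) x = f x"
proof -
  obtain g0 where f_diff: "f differentiable_on {a..b}" and f0: "f a = 0" "f b = 0"
    and g0_diff: "g0 differentiable_on {a..b}" and g0_cont: "continuous_on {a..b} (deriv_on a b g0)"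
    and f_deriv: "\<And>y. y \<in> {a..b} \<Longrightarrow> deriv_on a b f y = exp (W y) * g0 y"
    using f by (auto simp: brox_dom_def C1_on_def)
  define h where "h = brox_gen W a b f"
  have flux: "flux W a b f y = g0 y" if "y \<in> {a..b}" for y
    using f_deriv[OF that] by (simp add: flux_def exp_minus)
  have "deriv_on a b (flux W a b f) y = deriv_on a b g0 y" if y: "y \<in> {a..b}" for y
    using has_vector_derivative_transform[OF y flux has_vector_derivative_deriv_on[OF g0_diff y]]
    by (intro deriv_on_eq \<open>a < b\<close> y)
  then have h_eq: "h y = exp (W y) / 2 * deriv_on a b g0 y" if "y \<in> {a..b}" for y
    using that by (simp add: h_def brox_gen_def)
  then have "continuous_on {a..b} h"
    by (subst continuous_on_cong[OF refl h_eq]) (auto intro!: continuous_intros W g0_cont)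
  then have h: "integrable (lebesgue_on {a..b}) h"
    by (rule continuous_imp_integrable_real)
  have int: "integral {y..b} (\<lambda>z. 2 * exp (- W z) * h z) = g0 b - g0 y" if y: "y \<in> {a..b}" for y
  proof -
    have "((\<lambda>z. 2 * exp (- W z) * h z) has_integral g0 b - g0 y) {y..b}"
    proof (rule fundamental_theorem_of_calculus)
      fix z assume "z \<in> {y..b}"
      then have z: "z \<in> {a..b}" using y by auto
      have "2 * exp (- W z) * h z = deriv_on a b g0 z"
        by (simp add: h_eq[OF z] exp_minus)
      then show "(g0 has_vector_derivative 2 * exp (- W z) * h z) (at z within {y..b})"
        using has_vector_derivative_within_subset[OF has_vector_derivative_deriv_on[OF g0_diff z]] y
        by auto
    qed (use y in auto)
    then show ?thesis by (rule integral_unique)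
  qed
  obtain c where c: "\<And>y. y \<in> {a..b} \<Longrightarrow>
      (green_op W a b h has_vector_derivative exp (W y) * (c - (g0 b - g0 y))) (at y within {a..b})"
    using green_op_has_vector_derivative[OF W \<open>a < b\<close> h] int by metis
  let ?k = "c - g0 b"
  let ?e = "\<lambda>y. green_op W a b h y - f y - ?k * scale_fun W a y"
  have "(?e has_vector_derivative 0) (at y within {a..b})" if y: "y \<in> {a..b}" for y
  proof -
    have "(?e has_vector_derivative
        exp (W y) * (c - (g0 b - g0 y)) - exp (W y) * g0 y - ?k * exp (W y)) (at y within {a..b})"
      using has_vector_derivative_deriv_on[OF f_diff y] f_deriv[OF y]
      by (intro has_vector_derivative_diff has_vector_derivative_mult_right c y
          scale_fun_has_vector_derivative W) simp
    then show ?thesis by (simp add: algebra_simps)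
  qed
  then obtain d where d: "\<And>y. y \<in> {a..b} \<Longrightarrow> ?e y = d"
    using has_vector_derivative_zero_constant[OF convex_real_interval(5), of a b ?e] by blast
  \<comment> \<open>The two boundary conditions remove first the additive constant, then the multiple of \<open>s\<close>.\<close>
  note boundary = green_op_boundary[OF W \<open>a < b\<close> h] f0
  have "?e a = d"
    using \<open>a < b\<close> by (intro d) simp
  then have d0: "d = 0"
    by (simp add: boundary)
  have "?e b = d"
    using \<open>a < b\<close> by (intro d) simp
  then have "?k * scale_fun W a b = 0"
    by (simp add: boundary d0)
  then have "?k = 0"
    using scale_fun_pos[OF W \<open>a < b\<close>] by simp
  then show ?thesis
    using d[OF x] d0 by (simp add: h_def)
qed

lemma L2_on_imp_integrable:
  assumes "h \<in> L2_on a b"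
  shows "integrable (lebesgue_on {a..b}) h"
  using assms finite_measure.square_integrable_imp_integrable[OF finite_measure_lebesgue_on]
  by (auto simp: L2_on_def)

lemma flux_green_op_has_vector_derivative_AE:
  fixes h :: "real \<Rightarrow> real"
  assumes W: "continuous_on {a..b} W" and "a < b" and h: "integrable (lebesgue_on {a..b}) h"
  shows "AE x in lebesgue_on {a..b}.
    (flux W a b (green_op W a b h) has_vector_derivative 2 * exp (- W x) * h x) (at x within {a..b})"
proof -
  define m where "m = (\<lambda>z. 2 * exp (- W z) * h z)"
  have "integrable (lebesgue_on {a..b}) m"
    unfolding m_def by (intro integrable_continuous_mult h continuous_intros W)
  then have m_int: "m integrable_on {a..b}"
    by (auto intro: integrable_on_lebesgue_on)
  obtain c where c: "\<And>x. x \<in> {a..b} \<Longrightarrow>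
      (green_op W a b h has_vector_derivative exp (W x) * (c - integral {x..b} m)) (at x within {a..b})"
    using green_op_has_vector_derivative[OF W \<open>a < b\<close> h] unfolding m_def by metis
  have flux: "flux W a b (green_op W a b h) x = c - integral {a..b} m + integral {a..x} m"
    if x: "x \<in> {a..b}" for x
  proof -
    have "integral {a..x} m + integral {x..b} m = integral {a..b} m"
      using x by (intro Henstock_Kurzweil_Integration.integral_combine m_int) auto
    then show ?thesis
      by (simp add: flux_def deriv_on_eq[OF \<open>a < b\<close> x c[OF x]] mult.assoc[symmetric]
          exp_minus left_inverse)
  qed
  \<comment> \<open>The flux is given by this formula at every point, so only the outer derivative costs a null set.\<close>
  obtain N where N: "negligible N" and deriv: "\<And>x. x \<in> {a..b} - N \<Longrightarrow>
      ((\<lambda>t. integral {a..t} m) has_vector_derivative m x) (at x within {a..b})"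
    using indefinite_integral_has_vector_derivative_AE[OF m_int] by blast
  have "(flux W a b (green_op W a b h) has_vector_derivative m x) (at x within {a..b})"
    if x: "x \<in> {a..b} - N" for x
  proof (rule has_vector_derivative_transform)
    show "((\<lambda>x. c - integral {a..b} m + integral {a..x} m) has_vector_derivative m x)
        (at x within {a..b})"
      using has_vector_derivative_add[OF has_vector_derivative_const deriv[OF x]] by simp
  qed (use x flux in auto)
  moreover have "AE x in lebesgue. x \<notin> N"
    using N by (simp add: negligible_iff_null_sets AE_not_in)
  ultimately show ?thesis
    unfolding m_def by (subst AE_restrict_space_iff) (auto elim!: eventually_mono)
qed

theorem theorem7:
  fixes W :: "real \<Rightarrow> real" and a b :: real
  assumes "a < b" and "continuous_on UNIV W"
  shows "(\<forall>f\<in>brox_dom W a b. \<forall>x\<in>{a..b}. green_op W a b (brox_gen W a b f) x = f x) \<and>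
    (\<forall>h\<in>L2_on a b.
       green_op W a b h differentiable_on {a..b} \<and>
       (AE x in lebesgue_on {a..b}.
          flux W a b (green_op W a b h) differentiable (at x within {a..b}) \<and>
          brox_gen W a b (green_op W a b h) x = h x))"
proof (intro conjI ballI)
  have W: "continuous_on {a..b} W"
    using assms(2) continuous_on_subset by blast
  show "green_op W a b (brox_gen W a b f) x = f x" if "f \<in> brox_dom W a b" "x \<in> {a..b}" for f x
    using green_op_brox_gen[OF W \<open>a < b\<close> that] .
  fix h assume "h \<in> L2_on a b"
  then have h: "integrable (lebesgue_on {a..b}) h"
    by (rule L2_on_imp_integrable)
  show "green_op W a b h differentiable_on {a..b}"
    unfolding differentiable_on_def
    by (rule green_op_has_vector_derivative[OF W \<open>a < b\<close> h]) (blast intro: differentiableI_vector)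
  show "AE x in lebesgue_on {a..b}.
      flux W a b (green_op W a b h) differentiable (at x within {a..b}) \<and>
      brox_gen W a b (green_op W a b h) x = h x"
    using flux_green_op_has_vector_derivative_AE[OF W \<open>a < b\<close> h] AE_space
  proof eventually_elim
    case (elim x)
    then have x: "x \<in> {a..b}" by simp
    have "deriv_on a b (flux W a b (green_op W a b h)) x = 2 * exp (- W x) * h x"
      by (rule deriv_on_eq[OF \<open>a < b\<close> x elim(1)])
    then show ?case
      using differentiableI_vector[OF elim(1)] by (simp add: brox_gen_def exp_minus)
  qed
qed

end
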